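(* Let $m,n\ge 1$ be integers, let $A=\mathbb{Z}\langle x_1,x_2\rangle/(x_1^m,x_2^n)$, and put $y=[x_1,x_2]$, $z_1=[x_1,y]$, $z_2=[x_2,y]$. Then the free part of $N_3(A)$, i.e. the quotient of $N_3(A)$ by its torsion submodule, is generated as a $\mathbb{Z}$-module by (the images of) the elements $x_1^ix_2^jz_1$, $x_1^ix_2^jz_2$, $x_1^ix_2^jy^2$ for $0\le i\le m-1$, $0\le j\le n-1$.
   Context: For an associative ring $A$, define $L_1(A)=A$ and $L_{i+1}(A)=[A,L_i(A)]$ (the additive span of all commutators $[a,l]=al-la$ with $a\in A$, $l\in L_i(A)$), $M_i(A)=A\,L_i(A)\,A$ (the two-sided ideal generated by $L_i(A)$), and $N_i(A)=M_i(A)/M_{i+1}(A)$. The elements $z_1,z_2,y^2$ lie in $M_3(A)$. *)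

theory Defs
  imports "HOL-Library.Poly_Mapping" "HOL-Algebra.Algebra" "HOL-Algebra.Algebraic_Closure_Type"
begin

text \<open>
  Words under concatenation form the free monoid, so finitely supported integer-valued
  functions on words, with the convolution product of \<^theory>\<open>HOL-Library.Poly_Mapping\<close>,
  form the free associative unital ring on the letters.
\<close>

instantiation list :: (type) monoid_add
begin

definition zero_list :: "'a list" where "zero_list = []"

definition plus_list :: "'a list \<Rightarrow> 'a list \<Rightarrow> 'a list" where "plus_list = append"

instance by standard (simp_all add: zero_list_def plus_list_def)

end

definition free_ring :: "('x list \<Rightarrow>\<^sub>0 int) ring" where
  "free_ring = ring_of_type_algebra"

definition free_gen :: "'x \<Rightarrow> ('x list \<Rightarrow>\<^sub>0 int)" where
  "free_gen x = Poly_Mapping.single [x] 1"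

lemma ring_free_ring: "ring (free_ring :: ('x list \<Rightarrow>\<^sub>0 int) ring)"
proof -
  have "\<exists>y. x + y = 0" for x :: "'x list \<Rightarrow>\<^sub>0 int"
    using add.right_inverse by blast
  then show ?thesis
    unfolding free_ring_def ring_of_type_algebra_def
    by unfold_locales (auto simp: algebra_simps Units_def)
qed

datatype letter = X1 | X2

definition rel_ideal :: "nat \<Rightarrow> nat \<Rightarrow> (letter list \<Rightarrow>\<^sub>0 int) set" where
  "rel_ideal m n =
     Idl\<^bsub>free_ring\<^esub> {free_gen X1 [^]\<^bsub>free_ring\<^esub> m, free_gen X2 [^]\<^bsub>free_ring\<^esub> n}"

definition trunc_ring :: "nat \<Rightarrow> nat \<Rightarrow> (letter list \<Rightarrow>\<^sub>0 int) set ring" where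
  "trunc_ring m n = free_ring Quot (rel_ideal m n)"

definition trunc_gen :: "nat \<Rightarrow> nat \<Rightarrow> letter \<Rightarrow> (letter list \<Rightarrow>\<^sub>0 int) set" where
  "trunc_gen m n x = rel_ideal m n +>\<^bsub>free_ring\<^esub> free_gen x"

definition commutator :: "('a, 'b) ring_scheme \<Rightarrow> 'a \<Rightarrow> 'a \<Rightarrow> 'a" where
  "commutator R a b = a \<otimes>\<^bsub>R\<^esub> b \<ominus>\<^bsub>R\<^esub> b \<otimes>\<^bsub>R\<^esub> a"

text \<open>The series is indexed from 1; the value at index 0 is a dummy.\<close>

fun lcs :: "('a, 'b) ring_scheme \<Rightarrow> nat \<Rightarrow> 'a set" where
  "lcs R 0 = carrier R"
| "lcs R (Suc 0) = carrier R"
| "lcs R (Suc (Suc i)) =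
     generate (add_monoid R) {commutator R a l | a l. a \<in> carrier R \<and> l \<in> lcs R (Suc i)}"

definition lcs_ideal :: "('a, 'b) ring_scheme \<Rightarrow> nat \<Rightarrow> 'a set" where
  "lcs_ideal R i = Idl\<^bsub>R\<^esub> (lcs R i)"

text \<open>
  The quotient \<open>N\<^sub>i = M\<^sub>i / M\<^sub>i\<^sub>+\<^sub>1\<close> is the additive group, written multiplicatively as in
  \<^theory>\<open>HOL-Algebra.Group\<close>; its \<open>\<int>\<close>-module structure is given by powers.
\<close>

definition lcs_quot :: "('a, 'b) ring_scheme \<Rightarrow> nat \<Rightarrow> 'a set monoid" where
  "lcs_quot R i = (add_monoid R)\<lparr>carrier := lcs_ideal R i\<rparr> Mod lcs_ideal R (Suc i)"

definition torsion :: "('a, 'b) monoid_scheme \<Rightarrow> 'a set" where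
  "torsion G = {g \<in> carrier G. \<exists>k::nat. k > 0 \<and> g [^]\<^bsub>G\<^esub> k = \<one>\<^bsub>G\<^esub>}"

definition free_part :: "('a, 'b) monoid_scheme \<Rightarrow> 'a set monoid" where
  "free_part G = G Mod torsion G"

definition lcs_free_class :: "('a, 'b) ring_scheme \<Rightarrow> nat \<Rightarrow> 'a \<Rightarrow> 'a set set" where
  "lcs_free_class R i a =
     torsion (lcs_quot R i) #>\<^bsub>lcs_quot R i\<^esub> (lcs_ideal R (Suc i) +>\<^bsub>R\<^esub> a)"

end

theory Submission
  imports Defs "HOL-Computational_Algebra.Group_Closure"
begin

text \<open>
  In the free ring on \<open>x\<^sub>1, x\<^sub>2\<close> let \<open>K\<close> consist of the elements with a nonzero multiple whose image
  in \<open>A\<close> lies in \<open>M\<^sub>4(A)\<close>, so that triple commutators are central modulo \<open>K\<close>. Expanding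
  \<open>[x\<^sub>2,[x\<^sub>1,x\<^sub>2x\<^sub>1]] = z\<^sub>2x\<^sub>1 - y\<^sup>2\<close> and \<open>[x\<^sub>2,[x\<^sub>1,x\<^sub>2x\<^sub>1\<^sup>2]]\<close>, and commuting them with the generators,
  gives \<open>2yz\<^sub>1, 3yz\<^sub>2, 2y\<^sup>3 \<in> K\<close>. Hence \<open>z\<^sub>1, z\<^sub>2, y\<^sup>2\<close> are central modulo \<open>K\<close> and are annihilated by
  all commutators, so the \<open>\<int>\<close>-span of the elements \<open>x\<^sub>1\<^sup>ix\<^sub>2\<^sup>jw\<close> with \<open>w \<in> {z\<^sub>1, z\<^sub>2, y\<^sup>2}\<close> is a
  two-sided ideal modulo \<open>K\<close>. Every ideal that contains \<open>z\<^sub>1, z\<^sub>2, y\<^sup>2\<close> contains all triple commutators,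
  so this ideal maps onto a set containing \<open>M\<^sub>3(A)\<close>.
\<close>

section \<open>Commutators in a ring with two generators\<close>

text \<open>Type-class counterpart of \<open>commutator\<close>, so that identities in the free ring
  become goals for \<open>algebra_simps\<close>.\<close>

definition comm :: "'a::ring_1 \<Rightarrow> 'a \<Rightarrow> 'a" where
  "comm u v = u * v - v * u"

lemma comm_diff_left: "comm (u - v) w = comm u w - comm v w"
  and comm_diff_right: "comm w (u - v) = comm w u - comm w v"
  and comm_mult_left: "comm (u * v) w = u * comm v w + comm u w * v"
  and comm_mult_right: "comm w (u * v) = u * comm w v + comm w u * v"
  and comm_one_left: "comm 1 w = 0"
  and comm_zero_right: "comm w 0 = 0"
  and comm_swap: "comm u v = - comm v u"
  by (simp_all add: comm_def algebra_simps)

locale two_sided_ideal =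
  fixes J :: "'a::ring_1 set"
  assumes zero_mem: "0 \<in> J"
    and diff_mem: "\<And>u v. u \<in> J \<Longrightarrow> v \<in> J \<Longrightarrow> u - v \<in> J"
    and mult_left_mem: "\<And>u v. v \<in> J \<Longrightarrow> u * v \<in> J"
    and mult_right_mem: "\<And>u v. u \<in> J \<Longrightarrow> u * v \<in> J"
begin

lemma minus_mem: "u \<in> J \<Longrightarrow> - u \<in> J"
  using diff_mem[OF zero_mem] by simp

lemma add_mem: "u \<in> J \<Longrightarrow> v \<in> J \<Longrightarrow> u + v \<in> J"
  using diff_mem[of u "- v"] minus_mem by simp

lemmas closed = zero_mem diff_mem add_mem minus_mem mult_left_mem mult_right_mem

end

text \<open>The assumption says that a subring containing \<open>a\<close> and \<open>b\<close> is
  the whole ring. It acts as an induction principle, with \<open>S\<close> the set of elements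
  having the desired property.\<close>

locale two_generated =
  fixes a b :: "'a::ring_1"
  assumes generated: "\<And>S r. 1 \<in> S \<Longrightarrow> a \<in> S \<Longrightarrow> b \<in> S \<Longrightarrow>
    (\<And>u v. u \<in> S \<Longrightarrow> v \<in> S \<Longrightarrow> u - v \<in> S) \<Longrightarrow>
    (\<And>u v. u \<in> S \<Longrightarrow> v \<in> S \<Longrightarrow> u * v \<in> S) \<Longrightarrow> r \<in> S"
begin

abbreviation "y \<equiv> comm a b"
abbreviation "z1 \<equiv> comm a y"
abbreviation "z2 \<equiv> comm b y"

text \<open>By the Leibniz rule, the elements commuting with \<open>w\<close> modulo
  \<open>J\<close> form a subring.\<close>

lemma central_mod_ideal:
  assumes "two_sided_ideal J" and "comm a w \<in> J" and "comm b w \<in> J"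
  shows "comm u w \<in> J"
proof -
  interpret two_sided_ideal J by fact
  have "u \<in> {u. comm u w \<in> J}"
    by (rule generated)
      (simp_all add: assms comm_diff_left comm_mult_left comm_one_left closed)
  then show ?thesis by simp
qed

text \<open>Centrality is used twice: modulo \<open>J\<close> the generators commute with
  everything, hence so does every \<open>v\<close>.\<close>

lemma comm_mem_ideal:
  assumes "two_sided_ideal J" and "y \<in> J"
  shows "comm u v \<in> J"
proof (rule central_mod_ideal[OF assms(1)])
  interpret two_sided_ideal J by fact
  have self: "comm c c \<in> J" for c
    by (simp add: comm_def closed)
  have ba: "comm b a \<in> J"
    using minus_mem[OF assms(2)] by (simp add: comm_swap[of b])
  have "comm v a \<in> J" "comm v b \<in> J"
    by (rule central_mod_ideal[OF assms(1)]; fact self ba assms(2))+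
  then show "comm a v \<in> J" "comm b v \<in> J"
    using minus_mem[of "comm v a"] minus_mem[of "comm v b"]
    by (simp_all add: comm_swap[of a v] comm_swap[of b v])
qed

lemma comm_annihilates_mod_ideal:
  assumes J: "two_sided_ideal J" and central: "\<And>u. comm u w \<in> J" and yw: "y * w \<in> J"
  shows "comm u v * t * w \<in> J"
proof -
  interpret two_sided_ideal J by fact
  \<comment> \<open>The free middle factor \<open>t\<close> makes \<open>?P\<close> stable under
    right multiplication too, so only \<open>y\<close> has to be found in it; there centrality of
    \<open>w\<close> moves \<open>t\<close> out of the way.\<close>
  let ?P = "{f. \<forall>t. f * t * w \<in> J}"
  have "two_sided_ideal ?P"
  proof
    fix f g assume f: "f \<in> ?P"
    then have "f * (g * t) * w \<in> J" for t
      by blast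
    then show "f * g \<in> ?P"
      by (simp add: mult.assoc)
    show "g * f \<in> ?P"
      using f mult_left_mem[of _ g] by (simp add: mult.assoc)
  qed (simp_all add: left_diff_distrib zero_mem diff_mem)
  moreover have "y \<in> ?P"
  proof safe
    fix t
    have "y * t * w = y * w * t + y * comm t w"
      by (simp add: comm_def algebra_simps)
    then show "y * t * w \<in> J"
      using central yw by (simp add: add_mem mult_left_mem mult_right_mem)
  qed
  ultimately have "comm u v \<in> ?P"
    by (rule comm_mem_ideal)
  then show ?thesis by simp
qed

text \<open>Modulo \<open>z1\<close>, \<open>z2\<close> and \<open>y\<^sup>2\<close> the element \<open>y\<close> is central and annihilates the commutators,
  and all commutators are multiples of \<open>y\<close>.\<close>

lemma triple_comm_mem_ideal:
  assumes J: "two_sided_ideal J" and "z1 \<in> J" and "z2 \<in> J" and yy: "y * y \<in> J"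
  shows "comm u (comm v w) \<in> J"
proof -
  interpret two_sided_ideal J by fact
  have central: "comm u y \<in> J" for u
    by (rule central_mod_ideal) fact+
  \<comment> \<open>Centrality alone is not stable under products: [u, f g] contains the term f
    [u, g], which the second condition controls.\<close>
  let ?V = "{f. (\<forall>u. comm u f \<in> J) \<and> (\<forall>u v t. comm u v * t * f \<in> J)}"
  have "two_sided_ideal ?V"
  proof
    fix f g assume "f \<in> ?V"
    then have f: "comm u f \<in> J" "comm u v * t * f \<in> J" for u v t
      by auto
    have "f * comm u g \<in> J" for u
    proof -
      have "f * comm u g = comm u g * 1 * f - comm (comm u g) f"
        by (simp add: comm_def algebra_simps)
      then show ?thesis
        by (simp only: diff_mem f)
    qed
    then show "f * g \<in> ?V"
      by (simp add: comm_mult_right mult.assoc[symmetric] f closed)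
    have "comm u g * f \<in> J" for u
      using f(2)[of u g 1] by simp
    moreover have "comm u v * t * (g * f) \<in> J" for u v t
      using f(2)[of u v "t * g"] by (simp add: mult.assoc)
    ultimately show "g * f \<in> ?V"
      by (simp add: comm_mult_right add_mem mult_left_mem f)
  qed (simp_all add: comm_diff_right right_diff_distrib comm_zero_right zero_mem diff_mem)
  moreover have "y \<in> ?V"
    using central comm_annihilates_mod_ideal[OF J central yy] by blast
  ultimately have "comm v w \<in> ?V"
    by (rule comm_mem_ideal)
  then show ?thesis by simp
qed

end

text \<open>The role of \<open>K\<close> is played by the elements with a nonzero multiple in the fourth
  lower central ideal.\<close>

locale isolated_four_comm_ideal = two_generated a b + two_sided_ideal K
  for a b :: "'a::ring_1" and K :: "'a set" +
  assumes isolated: "\<And>k::nat. \<And>f. k > 0 \<Longrightarrow> of_nat k * f \<in> K \<Longrightarrow> f \<in> K"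
    and four_comm_mem: "\<And>t u v w. comm t (comm u (comm v w)) \<in> K"
begin

section \<open>Relations between \<open>y\<close>, \<open>z1\<close> and \<open>z2\<close> modulo
  \<open>K\<close>\<close>

lemma half_mem: "f + f \<in> K \<Longrightarrow> f \<in> K"
  using isolated[of 2 f] by (simp only: of_nat_numeral mult_2)

lemma third_mem: "f + f + f \<in> K \<Longrightarrow> f \<in> K"
proof -
  have "of_nat 3 * f = f + f + f"
    using distrib_right[of 2 1 f] by (simp only: mult_2) simp
  then show "f + f + f \<in> K \<Longrightarrow> f \<in> K"
    using isolated[of 3 f] by simp
qed

text \<open>From [a, b a] = y a one gets [b, y a] = z2 a - y y. Commuting this with \<open>a\<close>
  leaves [a, z2] a - y z1 - z1 y, and the last two products agree modulo \<open>K\<close>.\<close>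

lemma y_z1_mem: "y * z1 \<in> K"
proof -
  have "y * z1 + y * z1 = comm a z2 * a + comm y z1 - comm a (comm b (comm a (b * a)))"
    by (simp add: comm_def algebra_simps)
  also have "\<dots> \<in> K"
    by (intro add_mem diff_mem mult_right_mem four_comm_mem)
  finally show ?thesis
    by (rule half_mem)
qed

text \<open>The same element z2 a - y y is commuted with \<open>b\<close>; now z2 [b, a] = - z2 y
  contributes a third copy.\<close>

lemma y_z2_mem: "y * z2 \<in> K"
proof -
  have "y * z2 + y * z2 + y * z2 =
      comm b z2 * a + comm y z2 + comm y z2 - comm b (comm b (comm a (b * a)))"
    by (simp add: comm_def algebra_simps)
  also have "\<dots> \<in> K"
    by (intro add_mem diff_mem mult_right_mem four_comm_mem)
  finally show ?thesis
    by (rule third_mem)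
qed

lemma z_y_mem: "z1 * y \<in> K" "z2 * y \<in> K"
proof -
  have "z1 * y = y * z1 - comm y z1" "z2 * y = y * z2 - comm y z2"
    by (simp_all add: comm_def)
  then show "z1 * y \<in> K" "z2 * y \<in> K"
    using y_z1_mem y_z2_mem by (auto intro!: diff_mem four_comm_mem)
qed

text \<open>Commuting [a, b a a] = y a a twice with \<open>b\<close> produces y y y with coefficient
  2, and every other term lies in \<open>K\<close>.\<close>

lemma y_y_y_mem: "y * y * y \<in> K"
proof -
  \<comment> \<open>Here and in \<open>ya\<close> the letter \<open>a\<close> separates the two
    factors; moving it out costs only the fourfold commutator [a, z2].\<close>
  have za: "z2 * a * y \<in> K"
  proof -
    have "z2 * a * y = a * (z2 * y) - comm a z2 * y"
      by (simp add: comm_def algebra_simps)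
    then show ?thesis
      using z_y_mem by (simp add: closed four_comm_mem)
  qed
  have ya: "y * a * z2 \<in> K"
  proof -
    have "y * a * z2 = y * z2 * a + y * comm a z2"
      by (simp add: comm_def algebra_simps)
    then show ?thesis
      using y_z2_mem by (simp add: closed four_comm_mem)
  qed
  have "y * y * y + y * y * y =
      comm b (comm b (comm a (b * a * a))) - comm b z2 * a * a
      + z2 * y * a + z2 * y * a + z2 * a * y + z2 * a * y + y * z2 * a + y * a * z2"
    by (simp add: comm_def algebra_simps)
  also have "\<dots> \<in> K"
    by (intro add_mem diff_mem mult_right_mem[of "z2 * y"] mult_right_mem[of "y * z2"]
        mult_right_mem[of "comm b z2 * a"] mult_right_mem[of "comm b z2"]
        four_comm_mem z_y_mem y_z2_mem za ya)
  finally show ?thesis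
    by (rule half_mem)
qed

lemma y_mult_mem: "w \<in> {z1, z2, y * y} \<Longrightarrow> y * w \<in> K"
  using y_z1_mem y_z2_mem y_y_y_mem by (auto simp: mult.assoc)

text \<open>For \<open>z1\<close> and \<open>z2\<close> this is a fourfold commutator; for
  \<open>y * y\<close> the Leibniz rule leaves products of \<open>y\<close> with \<open>z1\<close>
  or \<open>z2\<close>.\<close>

lemma central_mod_K:
  assumes "w \<in> {z1, z2, y * y}"
  shows "comm u w \<in> K"
proof -
  have "comm u (y * y) \<in> K"
  proof (rule central_mod_ideal)
    show "comm a (y * y) \<in> K" "comm b (y * y) \<in> K"
      unfolding comm_mult_right by (intro add_mem y_z1_mem y_z2_mem z_y_mem)+
  qed unfold_locales
  then show ?thesis
    using assms four_comm_mem by auto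
qed

text \<open>This permits reordering the factors in front of \<open>w\<close> modulo
  \<open>K\<close>.\<close>

lemma comm_mult_mem: "w \<in> {z1, z2, y * y} \<Longrightarrow> comm u v * t * w \<in> K"
  by (rule comm_annihilates_mod_ideal) (unfold_locales, auto intro!: central_mod_K y_mult_mem)

section \<open>The span of the monomials modulo \<open>K\<close>\<close>

definition monomials :: "nat \<Rightarrow> nat \<Rightarrow> 'a set" where
  "monomials m n = {a ^ i * b ^ j * w | i j w. i < m \<and> j < n \<and> w \<in> {z1, z2, y * y}}"

text \<open>Since \<open>group_closure\<close> is the \<int>-span, this is the full preimage of the
  span in the quotient by \<open>K\<close>.\<close>

definition span_mod :: "nat \<Rightarrow> nat \<Rightarrow> 'a set" where
  "span_mod m n = {f. \<exists>s \<in> group_closure (monomials m n). f - s \<in> K}"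

lemma span_mod_base: "f \<in> K \<Longrightarrow> f \<in> span_mod m n"
  by (auto simp: span_mod_def intro!: bexI[of _ 0])

lemma span_mod_diff:
  assumes "f \<in> span_mod m n" and "g \<in> span_mod m n"
  shows "f - g \<in> span_mod m n"
proof -
  obtain s t where st: "s \<in> group_closure (monomials m n)" "f - s \<in> K"
      "t \<in> group_closure (monomials m n)" "g - t \<in> K"
    using assms by (auto simp: span_mod_def)
  have "(f - g) - (s - t) = (f - s) - (g - t)"
    by simp
  then have "(f - g) - (s - t) \<in> K"
    by (simp only: diff_mem st)
  then show ?thesis
    unfolding span_mod_def using group_closure.diff[OF st(1,3)] by blast
qed

lemma span_mod_cong:
  assumes "f - g \<in> K" and "g \<in> span_mod m n"
  shows "f \<in> span_mod m n"
  using span_mod_diff[OF span_mod_base[OF assms(1)], of "0 - g"]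
    span_mod_diff[OF span_mod_base[OF zero_mem] assms(2)]
  by simp

text \<open>Reduces multiplication by a generator, from either side, to the case of a
  monomial.\<close>

lemma span_mod_additive_image:
  assumes f: "f \<in> span_mod m n"
    and diff: "\<And>u v. h (u - v) = h u - h v"
    and K: "\<And>u. u \<in> K \<Longrightarrow> h u \<in> K"
    and mono: "\<And>u. u \<in> monomials m n \<Longrightarrow> h u \<in> span_mod m n"
  shows "h f \<in> span_mod m n"
proof -
  obtain s where s: "s \<in> group_closure (monomials m n)" "f - s \<in> K"
    using f by (auto simp: span_mod_def)
  from s(1) have "h s \<in> span_mod m n"
  proof induction
    case (base s)
    have "h 0 = 0"
      using diff[of 0 0] by simp
    with base show ?case
      using mono span_mod_base[OF zero_mem] by auto
  next
    case (diff s t)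
    then show ?case
      by (simp add: assms(2) span_mod_diff)
  qed
  moreover have "h f - h s \<in> K"
    using K[OF s(2)] by (simp add: diff)
  ultimately show ?thesis
    by (rule span_mod_cong[rotated])
qed

context
  fixes m n :: nat
  assumes a_pow: "a ^ m \<in> K" and b_pow: "b ^ n \<in> K"
begin

text \<open>The exponents are unbounded here: if one is too large, \<open>a ^ m\<close> or
  \<open>b ^ n\<close> splits off and the product lies in \<open>K\<close>.\<close>

lemma pow_mult_mem_span_mod:
  assumes w: "w \<in> {z1, z2, y * y}"
  shows "a ^ i * b ^ j * w \<in> span_mod m n"
proof (cases "i < m \<and> j < n")
  case True
  then have "a ^ i * b ^ j * w \<in> group_closure (monomials m n)"
    using w by (intro group_closure.base) (auto simp: monomials_def)
  then show ?thesis
    unfolding span_mod_def using zero_mem by force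
next
  case False
  have "a ^ i = a ^ m * a ^ (i - m)" if "\<not> i < m"
    using that by (simp flip: power_add)
  moreover have "b ^ j = b ^ n * b ^ (j - n)" if "\<not> j < n"
    using that by (simp flip: power_add)
  ultimately have "a ^ i \<in> K \<or> b ^ j \<in> K"
    using False a_pow b_pow mult_right_mem by metis
  then show ?thesis
    by (blast intro: span_mod_base mult_right_mem mult_left_mem)
qed

text \<open>Left multiplication by \<open>a\<close> raises \<open>i\<close>. Otherwise the new
  letter is moved into place, past a power because commutators annihilate \<open>w\<close>, and past
  \<open>w\<close> by centrality.\<close>

lemma mult_mem_span_mod:
  assumes f: "f \<in> span_mod m n"
  shows "a * f \<in> span_mod m n" "b * f \<in> span_mod m n"
    "f * a \<in> span_mod m n" "f * b \<in> span_mod m n"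
proof -
  have *: "a * u \<in> span_mod m n \<and> b * u \<in> span_mod m n \<and>
      u * a \<in> span_mod m n \<and> u * b \<in> span_mod m n"
    if "u \<in> monomials m n" for u
  proof -
    obtain i j w where u: "u = a ^ i * b ^ j * w" and w: "w \<in> {z1, z2, y * y}"
      using \<open>u \<in> monomials m n\<close> unfolding monomials_def by blast
    note mem = pow_mult_mem_span_mod[OF w]
    have "a * u \<in> span_mod m n"
      using mem[of "Suc i" j] by (simp add: u mult.assoc)
    moreover have "b * u \<in> span_mod m n"
    proof (rule span_mod_cong)
      have "b * u - a ^ i * b ^ Suc j * w = comm b (a ^ i) * b ^ j * w"
        by (simp add: u comm_def algebra_simps)
      then show "b * u - a ^ i * b ^ Suc j * w \<in> K"
        by (simp only: comm_mult_mem[OF w])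
    qed (rule mem)
    moreover have "u * a \<in> span_mod m n"
    proof (rule span_mod_cong)
      \<comment> \<open>The factor \<open>1\<close> plays the role of \<open>t\<close> in
        \<open>comm_mult_mem\<close>.\<close>
      have "u * a - a ^ Suc i * b ^ j * w
          = - (a ^ i * (comm a (b ^ j) * 1 * w)) - a ^ i * b ^ j * comm a w"
        by (simp add: u comm_def algebra_simps power_Suc2 del: power_Suc)
      then show "u * a - a ^ Suc i * b ^ j * w \<in> K"
        by (simp only:)
          (intro diff_mem minus_mem mult_left_mem comm_mult_mem[OF w] central_mod_K[OF w])
    qed (rule mem)
    moreover have "u * b \<in> span_mod m n"
    proof (rule span_mod_cong)
      have "u * b - a ^ i * b ^ Suc j * w = - (a ^ i * b ^ j * comm b w)"
        by (simp add: u comm_def algebra_simps power_Suc2 del: power_Suc)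
      then show "u * b - a ^ i * b ^ Suc j * w \<in> K"
        by (simp only:) (intro minus_mem mult_left_mem central_mod_K[OF w])
    qed (rule mem)
    ultimately show ?thesis by blast
  qed
  show "a * f \<in> span_mod m n" "b * f \<in> span_mod m n"
    "f * a \<in> span_mod m n" "f * b \<in> span_mod m n"
    by (rule span_mod_additive_image[OF f, where h = "(*) a"]
          span_mod_additive_image[OF f, where h = "(*) b"]
          span_mod_additive_image[OF f, where h = "\<lambda>u. u * a"]
          span_mod_additive_image[OF f, where h = "\<lambda>u. u * b"];
        simp add: * closed right_diff_distrib left_diff_distrib)+
qed

text \<open>The elements that preserve the span under multiplication from a fixed side form a
  subring, so the generators suffice.\<close>

lemma two_sided_ideal_span_mod: "two_sided_ideal (span_mod m n)"
proof
  fix u v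
  have "u \<in> {u. \<forall>f \<in> span_mod m n. u * f \<in> span_mod m n}"
    by (rule generated) (auto simp: mult_mem_span_mod span_mod_diff left_diff_distrib mult.assoc)
  then show "u * v \<in> span_mod m n" if "v \<in> span_mod m n"
    using that by blast
  have "v \<in> {v. \<forall>f \<in> span_mod m n. f * v \<in> span_mod m n}"
    by (rule generated)
      (auto simp: mult_mem_span_mod span_mod_diff right_diff_distrib mult.assoc[symmetric])
  then show "u * v \<in> span_mod m n" if "u \<in> span_mod m n"
    using that by blast
qed (auto simp: span_mod_diff span_mod_base zero_mem)

lemma triple_comm_mem_span_mod: "comm u (comm v w) \<in> span_mod m n"
  by (rule triple_comm_mem_ideal[OF two_sided_ideal_span_mod])
    (use pow_mult_mem_span_mod[of _ 0 0] in auto)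

end

end

section \<open>The lower central quotients modulo torsion\<close>

text \<open>By commutativity, the product of two exponents kills the product of the two
  elements.\<close>

lemma (in comm_group) subgroup_torsion: "subgroup (torsion G) G"
proof
  show "torsion G \<subseteq> carrier G"
    by (auto simp: torsion_def)
  show "\<one> \<in> torsion G"
    by (auto simp: torsion_def intro: exI[of _ 1])
next
  fix x assume "x \<in> torsion G"
  then obtain k :: nat where "x \<in> carrier G" "k > 0" "x [^] k = \<one>"
    by (auto simp: torsion_def)
  then show "inv x \<in> torsion G"
    by (auto simp: torsion_def nat_pow_inv intro: exI[of _ k])
next
  fix x z assume "x \<in> torsion G" "z \<in> torsion G"
  then obtain k l :: nat where x: "x \<in> carrier G" "k > 0" "x [^] k = \<one>"
      and z: "z \<in> carrier G" "l > 0" "z [^] l = \<one>"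
    by (auto simp: torsion_def)
  have "(x \<otimes> z) [^] (k * l) = (x [^] k) [^] l \<otimes> (z [^] l) [^] k"
    using x(1) z(1) by (simp add: nat_pow_distrib nat_pow_pow mult.commute)
  also have "\<dots> = \<one>"
    using x z by simp
  finally show "x \<otimes> z \<in> torsion G"
    using x z by (auto simp: torsion_def intro!: exI[of _ "k * l"])
qed

context ring
begin

lemma commutator_closed [simp]:
  "x \<in> carrier R \<Longrightarrow> z \<in> carrier R \<Longrightarrow> commutator R x z \<in> carrier R"
  by (simp add: commutator_def)

lemma lcs_subset: "lcs R i \<subseteq> carrier R"
proof (induction i)
  case (Suc i)
  then show ?case
    by (cases i) (auto dest!: add.generate_in_carrier[rotated])
qed simp

lemma ideal_lcs_ideal: "ideal (lcs_ideal R i) R"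
  unfolding lcs_ideal_def by (rule genideal_ideal[OF lcs_subset])

text \<open>A commutator [x, l] lies in every ideal containing \<open>l\<close>. The inclusion is
  what makes \<open>lcs_quot\<close> a genuine quotient group.\<close>

lemma lcs_ideal_Suc_subset: "lcs_ideal R (Suc (Suc i)) \<subseteq> lcs_ideal R (Suc i)"
proof -
  interpret I: ideal "lcs_ideal R (Suc i)" R
    by (rule ideal_lcs_ideal)
  have "commutator R x l \<in> lcs_ideal R (Suc i)" if "x \<in> carrier R" "l \<in> lcs R (Suc i)" for x l
  proof -
    have "l \<in> lcs_ideal R (Suc i)"
      using that(2) genideal_self[OF lcs_subset] unfolding lcs_ideal_def by blast
    then show ?thesis
      using that(1) by (simp add: commutator_def a_minus_def I.I_l_closed I.I_r_closed)
  qed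
  then have "lcs R (Suc (Suc i)) \<subseteq> lcs_ideal R (Suc i)"
    unfolding lcs.simps
    by (intro add.generate_subgroup_incl) (auto simp: I.a_subgroup)
  then show ?thesis
    unfolding lcs_ideal_def[of R "Suc (Suc i)"]
    by (rule genideal_minimal[OF ideal_lcs_ideal])
qed

text \<open>In the generators [x, l] of the third term, \<open>l\<close> is only a sum of
  commutators up to sign; additivity in \<open>l\<close> reduces to pure triple commutators.\<close>

lemma lcs_ideal_3_subset:
  assumes J: "ideal J R"
    and comm: "\<And>x z w. x \<in> carrier R \<Longrightarrow> z \<in> carrier R \<Longrightarrow> w \<in> carrier R \<Longrightarrow>
      commutator R x (commutator R z w) \<in> J"
  shows "lcs_ideal R 3 \<subseteq> J"
proof -
  interpret J: ideal J R by fact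
  let ?G = "{commutator R z w | z w. z \<in> carrier R \<and> w \<in> carrier R}"
  have "commutator R x l \<in> J" if "x \<in> carrier R" and l: "l \<in> generate (add_monoid R) ?G" for x l
    using l
  proof (induction l)
    case one
    then show ?case
      using that(1) by (simp add: commutator_def minus_eq)
  next
    case (incl h)
    then show ?case
      using comm that(1) by blast
  next
    case (inv h)
    then have h: "h \<in> carrier R" "commutator R x h \<in> J"
      using comm that(1) by auto
    have "commutator R x (\<ominus> h) = \<ominus> commutator R x h"
      using h(1) that(1) by (simp add: commutator_def minus_eq l_minus r_minus minus_add a_comm)
    with h(2) show ?case
      unfolding a_inv_def[symmetric] by (simp only: J.a_inv_closed)
  next
    case (eng h1 h2)
    then have h: "h1 \<in> carrier R" "h2 \<in> carrier R"
      by (auto dest!: add.generate_in_carrier[rotated])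
    have "commutator R x (h1 \<oplus> h2) = commutator R x h1 \<oplus> commutator R x h2"
      using h that(1)
      by (simp add: commutator_def minus_eq l_distr r_distr minus_add a_ac)
    then show ?case
      using eng.IH by simp
  qed
  then have "lcs R 3 \<subseteq> J"
    unfolding numeral_3_eq_3 lcs.simps
    by (intro add.generate_subgroup_incl) (auto simp: J.a_subgroup)
  then show ?thesis
    unfolding lcs_ideal_def by (rule genideal_minimal[OF J])
qed

text \<open>The class map is the composite of the projections onto the quotient by \<open>N\<close>
  and then onto its quotient by torsion; an element with a positive multiple in \<open>N\<close>
  becomes torsion after the first.\<close>

lemma lcs_free_class_hom:
  fixes i :: nat
  defines "M \<equiv> lcs_ideal R (Suc i)" and "N \<equiv> lcs_ideal R (Suc (Suc i))"
    and "F \<equiv> free_part (lcs_quot R (Suc i))" and "h \<equiv> lcs_free_class R (Suc i)"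
  shows "group_hom ((add_monoid R)\<lparr>carrier := M\<rparr>) F h" (is "group_hom ?H F h")
    and "h ` M = carrier F"
    and "k > 0 \<Longrightarrow> x \<in> M \<Longrightarrow> add_pow R (k::nat) x \<in> N \<Longrightarrow> h x = \<one>\<^bsub>F\<^esub>"
proof -
  interpret M: ideal M R
    unfolding M_def by (rule ideal_lcs_ideal)
  interpret N: ideal N R
    unfolding N_def by (rule ideal_lcs_ideal)
  have sub: "subgroup N ?H"
    by (intro add.subgroup_incl N.a_subgroup M.a_subgroup)
      (simp add: M_def N_def lcs_ideal_Suc_subset)
  interpret H: comm_group ?H
  proof (rule group.group_comm_groupI)
    show "group ?H"
      by (rule add.subgroup_imp_group[OF M.a_subgroup])
  qed (simp add: a_comm M.Icarr)
  define G where "G = ?H Mod N"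
  have G: "G = lcs_quot R (Suc i)"
    by (simp add: G_def lcs_quot_def M_def N_def)
  interpret G: comm_group G
    unfolding G_def by (rule H.abelian_FactGroup[OF sub])
  interpret N': normal N ?H
    by (rule H.subgroup_imp_normal[OF sub])
  interpret T: normal "torsion G" G
    by (rule G.subgroup_imp_normal[OF G.subgroup_torsion])
  have F: "F = G Mod torsion G"
    by (simp add: F_def free_part_def G)
  have coset: "N +> x = N #>\<^bsub>?H\<^esub> x" for x
    by (simp add: a_r_coset_def r_coset_def)
  have h: "h = (\<lambda>x. torsion G #>\<^bsub>G\<^esub> (N #>\<^bsub>?H\<^esub> x))"
    unfolding h_def lcs_free_class_def fun_eq_iff G[symmetric] N_def[symmetric] coset by simp
  have "(\<lambda>Y. torsion G #>\<^bsub>G\<^esub> Y) \<circ> (\<lambda>x. N #>\<^bsub>?H\<^esub> x) \<in> hom ?H F"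
    by (rule hom_compose) (use N'.r_coset_hom_Mod T.r_coset_hom_Mod in \<open>auto simp: F G_def\<close>)
  then show "group_hom ?H F h"
    unfolding h by unfold_locales
      (use T.factorgroup_is_group in \<open>auto simp: F comp_def group_def group_axioms_def monoid_def\<close>)
  show "h ` M = carrier F"
    unfolding h F carrier_FactGroup by (simp add: G_def carrier_FactGroup image_image)
  show "h x = \<one>\<^bsub>F\<^esub>" if "k > 0" "x \<in> M" "add_pow R (k::nat) x \<in> N"
  proof -
    have "(N #>\<^bsub>?H\<^esub> x) [^]\<^bsub>G\<^esub> k = N #>\<^bsub>?H\<^esub> (x [^]\<^bsub>?H\<^esub> k)"
      using N'.r_coset_hom_Mod that(2) G.is_group H.is_group
      by (subst hom_nat_pow[of _ ?H G]) (auto simp: G_def)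
    also have "x [^]\<^bsub>?H\<^esub> k = add_pow R k x"
      by (simp add: add_pow_def nat_pow_def)
    also have "N #>\<^bsub>?H\<^esub> \<dots> = N"
      by (rule N'.rcos_const[OF H.is_group that(3)])
    finally have "N #>\<^bsub>?H\<^esub> x \<in> torsion G"
      using that(1,2) unfolding torsion_def
      by (auto simp: G_def carrier_FactGroup)
    then show ?thesis
      by (simp add: h F T.rcos_const[OF G.is_group])
  qed
qed

end

section \<open>The truncated ring\<close>

lemma free_ring_simps [simp]:
  "carrier free_ring = UNIV"
  "x \<otimes>\<^bsub>free_ring\<^esub> z = x * z"
  "x \<oplus>\<^bsub>free_ring\<^esub> z = x + z"
  "\<one>\<^bsub>free_ring\<^esub> = 1"
  "\<zero>\<^bsub>free_ring\<^esub> = 0"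
  by (simp_all add: free_ring_def ring_of_type_algebra_def)

interpretation free_ring: ring "free_ring :: ('x list \<Rightarrow>\<^sub>0 int) ring"
  by (rule ring_free_ring)

lemma free_ring_pow [simp]: "x [^]\<^bsub>free_ring\<^esub> (k::nat) = x ^ k"
  by (induction k) (simp_all add: power_Suc2 del: power_Suc)

lemma free_ring_minus [simp]: "\<ominus>\<^bsub>free_ring\<^esub> x = - x"
  by (rule free_ring.minus_equality) simp_all

lemma free_ring_diff [simp]: "x \<ominus>\<^bsub>free_ring\<^esub> z = x - z"
  by (simp add: a_minus_def)

lemma commutator_free_ring: "commutator free_ring x z = comm x z"
  by (simp add: commutator_def comm_def)

lemma ideal_free_ring_iff: "ideal J free_ring \<longleftrightarrow> two_sided_ideal J"
proof
  assume "ideal J free_ring"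
  then interpret ideal J "free_ring :: ('a list \<Rightarrow>\<^sub>0 int) ring" .
  show "two_sided_ideal J"
  proof
    fix u v
    show "u - v \<in> J" if "u \<in> J" "v \<in> J"
      using that a_closed[of u "- v"] a_inv_closed[of v] by simp
  qed (use I_l_closed I_r_closed zero_closed in auto)
next
  assume "two_sided_ideal J"
  then interpret two_sided_ideal J .
  show "ideal J free_ring"
  proof (rule idealI[OF ring_free_ring])
    show "subgroup J (add_monoid free_ring)"
      by (rule free_ring.add.subgroupI)
        (use zero_mem in \<open>auto simp: a_inv_def[symmetric] minus_mem add_mem\<close>)
  qed (simp_all add: mult_left_mem mult_right_mem)
qed

text \<open>Words are products of letters, with the empty word as unit, and every element is an
  integer combination of words.\<close>

interpretation free_letters: two_generated "free_gen X1" "free_gen X2"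
proof
  fix S :: "(letter list \<Rightarrow>\<^sub>0 int) set" and r :: "letter list \<Rightarrow>\<^sub>0 int"
  assume one: "1 \<in> S" and gens: "free_gen X1 \<in> S" "free_gen X2 \<in> S"
    and diff: "\<And>u v. u \<in> S \<Longrightarrow> v \<in> S \<Longrightarrow> u - v \<in> S"
    and mult: "\<And>u v. u \<in> S \<Longrightarrow> v \<in> S \<Longrightarrow> u * v \<in> S"
  have word: "frag_of w \<in> S" for w
  proof (induction w)
    case Nil
    then show ?case
      using one by (simp add: zero_list_def[symmetric])
  next
    case (Cons x w)
    have "frag_of (x # w) = free_gen x * frag_of w"
      by (simp add: free_gen_def mult_single plus_list_def)
    moreover have "free_gen x \<in> S"
      using gens by (cases x) auto
    ultimately show ?case
      using Cons mult by simp
  qed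
  have "0 \<in> S"
    using diff[OF one one] by simp
  have "Poly_Mapping.keys r \<subseteq> UNIV" by simp
  then show "r \<in> S"
    by (induction r rule: frag_induction) (use word diff \<open>0 \<in> S\<close> in auto)
qed


lemma (in ring_hom_ring) hom_commutator:
  "x \<in> carrier R \<Longrightarrow> z \<in> carrier R \<Longrightarrow> h (commutator R x z) = commutator S (h x) (h z)"
  by (simp add: commutator_def a_minus_def)

theorem lemma3p8:
  fixes m n :: nat
  assumes "m \<ge> 1" and "n \<ge> 1"
  defines "A \<equiv> trunc_ring m n"
  defines "x1 \<equiv> trunc_gen m n X1"
    and "x2 \<equiv> trunc_gen m n X2"
  defines "y \<equiv> commutator A x1 x2"
  defines "z1 \<equiv> commutator A x1 y"
    and "z2 \<equiv> commutator A x2 y"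
  shows "carrier (free_part (lcs_quot A 3)) =
    generate (free_part (lcs_quot A 3))
      {lcs_free_class A 3 (x1 [^]\<^bsub>A\<^esub> i \<otimes>\<^bsub>A\<^esub> x2 [^]\<^bsub>A\<^esub> j \<otimes>\<^bsub>A\<^esub> w) | i j w.
         i \<le> m - 1 \<and> j \<le> n - 1 \<and> w \<in> {z1, z2, y [^]\<^bsub>A\<^esub> (2::nat)}}"
    (is "carrier ?F = generate ?F ?gens")
proof -

  \<comment> \<open>The projection \<open>p\<close> from the free ring onto \<open>A\<close>\<close>
  define I where "I = rel_ideal m n"
  define p where "p = (+>\<^bsub>free_ring\<^esub>) I"
  have I: "ideal I free_ring"
    unfolding I_def rel_ideal_def by (rule free_ring.genideal_ideal) simp
  have A: "A = free_ring Quot I"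
    by (simp add: A_def trunc_ring_def I_def)
  interpret p: ring_hom_ring free_ring A p
    unfolding A p_def by (rule ideal.rcos_ring_hom_ring[OF I])
  have carrier_A: "carrier A = range p"
    by (auto simp: A p_def FactRing_def A_RCOSETS_def')
  have p_gen: "p (free_gen X1) = x1" "p (free_gen X2) = x2"
    by (simp_all add: p_def x1_def x2_def trunc_gen_def I_def)
  have p_closed: "p f \<in> carrier A" for f
    by (simp add: carrier_A)
  have p_comm: "p (comm f g) = commutator A (p f) (p g)" for f g
    using p.hom_commutator[of f g] by (simp add: commutator_free_ring)
  have p_mult: "p (f * g) = p f \<otimes>\<^bsub>A\<^esub> p g" for f g
    using p.hom_mult[of f g] by simp
  have p_pow: "p (f ^ k) = p f [^]\<^bsub>A\<^esub> k" for f k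
    using p.hom_nat_pow[of f k] by simp
  have p_of_nat_mult: "p (of_nat k * f) = add_pow A k (p f)" for k f
  proof (induction k)
    case 0
    then show ?case
      using p.hom_zero by simp
  next
    case (Suc k)
    have "p (of_nat (Suc k) * f) = p (of_nat k * f) \<oplus>\<^bsub>A\<^esub> p f"
      using p.hom_add[of "of_nat k * f" f] by (simp add: distrib_right add.commute)
    then show ?case
      by (simp add: Suc.IH p_closed)
  qed
  have vimage: "two_sided_ideal {f. p f \<in> J}" if "ideal J A" for J
    using p.ideal_vimage[OF that] by (simp add: ideal_free_ring_iff)

  \<comment> \<open>The ideals \<open>M\<close> and \<open>N\<close> and the class map
    \<open>h\<close>\<close>
  define M where "M = lcs_ideal A (Suc 2)"
  define N where "N = lcs_ideal A (Suc (Suc 2))"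
  define h where "h = lcs_free_class A (Suc 2)"
  have three: "3 = Suc 2" by simp
  note hom = p.S.lcs_free_class_hom[where i = 2, folded M_def N_def h_def three]
  interpret h: group_hom "(add_monoid A)\<lparr>carrier := M\<rparr>" ?F h
    by (rule hom(1))
  interpret M: ideal M A
    unfolding M_def by (rule p.S.ideal_lcs_ideal)
  interpret pM: two_sided_ideal "{f. p f \<in> M}"
    by (rule vimage[OF M.is_ideal])
  interpret pN: two_sided_ideal "{f. p f \<in> N}"
    by (rule vimage) (simp add: N_def p.S.ideal_lcs_ideal)

  have lcs_mem: "commutator A x l \<in> lcs A (Suc (Suc i))"
    if "x \<in> carrier A" "l \<in> lcs A (Suc i)" for x l i
    using that by (auto intro!: generate.incl)
  have M_triple: "p (comm u (comm v w)) \<in> M" for u v w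
  proof -
    have "p (comm u (comm v w)) \<in> lcs A (Suc 2)"
      unfolding p_comm numeral_2_eq_2 by (intro lcs_mem) (simp_all add: p_closed)
    then show ?thesis
      using p.S.genideal_self[OF p.S.lcs_subset] unfolding M_def lcs_ideal_def by blast
  qed
  have N_four: "p (comm t (comm u (comm v w))) \<in> N" for t u v w
  proof -
    have "p (comm t (comm u (comm v w))) \<in> lcs A (Suc (Suc 2))"
      unfolding p_comm numeral_2_eq_2 by (intro lcs_mem) (simp_all add: p_closed)
    then show ?thesis
      using p.S.genideal_self[OF p.S.lcs_subset] unfolding N_def lcs_ideal_def by blast
  qed

  \<comment> \<open>The preimage under \<open>p\<close> of the torsion of \<open>A\<close> modulo
    \<open>N\<close>. Taking torsion in all of \<open>A\<close>, not just in \<open>M\<close>, makes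
    \<open>K\<close> an ideal to which the abstract results apply.\<close>
  define K where "K = {f. \<exists>k::nat. k > 0 \<and> p (of_nat k * f) \<in> N}"
  have K_base: "f \<in> K" if "p f \<in> N" for f
    using that unfolding K_def by (auto intro!: exI[of _ 1])
  interpret K: isolated_four_comm_ideal "free_gen X1" "free_gen X2" K
  proof
    fix f g
    show "f - g \<in> K" if "f \<in> K" "g \<in> K"
    proof -
      obtain k :: nat where k: "k > 0" "p (of_nat k * f) \<in> N"
        using \<open>f \<in> K\<close> by (auto simp: K_def)
      obtain l :: nat where l: "l > 0" "p (of_nat l * g) \<in> N"
        using \<open>g \<in> K\<close> by (auto simp: K_def)
      have "of_nat (k * l) * (f - g) = of_nat l * (of_nat k * f) - of_nat k * (of_nat l * g)"
        by (simp only: right_diff_distrib mult.assoc[symmetric] of_nat_mult[symmetric] mult.commute[of l k])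
      then have "p (of_nat (k * l) * (f - g)) \<in> N"
        using pN.diff_mem pN.mult_left_mem k(2) l(2) by (simp only: mem_Collect_eq)
      then show ?thesis
        using k(1) l(1) unfolding K_def by (auto intro!: exI[of _ "k * l"])
    qed
    show "f * g \<in> K" if "g \<in> K"
    proof -
      obtain k :: nat where k: "k > 0" "p (of_nat k * g) \<in> N"
        using \<open>g \<in> K\<close> by (auto simp: K_def)
      have "of_nat k * (f * g) = f * (of_nat k * g)"
        by (metis mult.assoc mult_of_nat_commute)
      then show ?thesis
        using k pN.mult_left_mem[of "of_nat k * g" f] unfolding K_def by auto
    qed
    show "f * g \<in> K" if "f \<in> K"
    proof -
      obtain k :: nat where k: "k > 0" "p (of_nat k * f) \<in> N"
        using \<open>f \<in> K\<close> by (auto simp: K_def)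
      then show ?thesis
        using pN.mult_right_mem[of "of_nat k * f" g] unfolding K_def by (auto simp: mult.assoc)
    qed
    show "f \<in> K" if k: "k > 0" and kf: "of_nat k * f \<in> K" for k :: nat
    proof -
      obtain l :: nat where l: "l > 0" "p (of_nat l * (of_nat k * f)) \<in> N"
        using kf by (auto simp: K_def)
      then have "p (of_nat (l * k) * f) \<in> N"
        by (simp add: mult.assoc)
      then show ?thesis
        using l(1) k unfolding K_def by (auto intro!: exI[of _ "l * k"])
    qed
  qed (use pN.zero_mem N_four in \<open>auto intro: K_base\<close>)

  have "p f \<in> N" if "f \<in> I" for f
    using free_ring.a_rcos_zero[OF I that] free_ring.a_rcos_zero[OF I, of 0] pN.zero_mem
      ideal_free_ring_iff[of I] I by (simp add: p_def two_sided_ideal.zero_mem)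
  \<comment> \<open>Both powers are relators, so \<open>p\<close> sends them to zero.\<close>
  then have pows: "free_gen X1 ^ m \<in> K" "free_gen X2 ^ n \<in> K"
    using free_ring.genideal_self[of "{free_gen X1 ^ m, free_gen X2 ^ n}"]
    by (auto intro!: K_base simp: I_def rel_ideal_def)

  define S where "S = K.span_mod m n"
  have S: "ideal S free_ring"
    unfolding S_def ideal_free_ring_iff by (rule K.two_sided_ideal_span_mod[OF pows])
  \<comment> \<open>Only an inclusion is claimed: \<open>S\<close> contains \<open>K\<close>, whose
    image need not lie in \<open>M\<close>.\<close>
  have M_subset: "M \<subseteq> p ` S"
    unfolding M_def three[symmetric]
  proof (rule p.S.lcs_ideal_3_subset)
    show "ideal (p ` S) A"
      unfolding A p_def by (rule free_ring.ring_ideal_imp_quot_ideal[OF I S])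
    fix u v w assume "u \<in> carrier A" "v \<in> carrier A" "w \<in> carrier A"
    then show "commutator A u (commutator A v w) \<in> p ` S"
      using K.triple_comm_mem_span_mod[OF pows]
      by (auto simp: carrier_A S_def p_comm[symmetric])
  qed

  have p_y: "p free_letters.y = y" and p_z: "p free_letters.z1 = z1" "p free_letters.z2 = z2"
    by (simp_all add: p_comm p_gen y_def z1_def z2_def)
  have p_yy: "p (free_letters.y * free_letters.y) = y [^]\<^bsub>A\<^esub> (2::nat)"
    using p_pow[of free_letters.y 2] by (simp add: p_y power2_eq_square)
  have M_w: "p w \<in> M" if "w \<in> {free_letters.z1, free_letters.z2,
      free_letters.y * free_letters.y}" for w
  proof -
    let ?a = "free_gen X1" and ?b = "free_gen X2"
    \<comment> \<open>The same expansion of [b, [a, b a]] shows that the square of \<open>y\<close>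
      maps into \<open>M\<close>.\<close>
    have "free_letters.y * free_letters.y =
        free_letters.z2 * ?a - comm ?b (comm ?a (?b * ?a))"
      by (simp add: comm_def algebra_simps)
    also have "\<dots> \<in> {f. p f \<in> M}"
      by (intro pM.diff_mem pM.mult_right_mem) (simp_all add: M_triple)
    finally show ?thesis
      using that M_triple by auto
  qed
  have gens: "?gens = (\<lambda>f. h (p f)) ` K.monomials m n"
  proof -
    define W where "W = {free_letters.z1, free_letters.z2, free_letters.y * free_letters.y}"
    have W: "{z1, z2, y [^]\<^bsub>A\<^esub> (2::nat)} = p ` W"
      by (simp only: W_def image_insert image_empty p_z p_yy)
    \<comment> \<open>Subtraction of naturals truncates at 0, so this rests on
      \<open>m \<ge> 1\<close> and \<open>n \<ge> 1\<close>.\<close>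
    have le: "i \<le> m - 1 \<longleftrightarrow> i < m" "j \<le> n - 1 \<longleftrightarrow> j < n" for i j
      using assms(1,2) by auto
    have "(\<lambda>f. h (p f)) ` K.monomials m n =
        {h (p (free_gen X1 ^ i * free_gen X2 ^ j * w)) | i j w. i < m \<and> j < n \<and> w \<in> W}"
      unfolding K.monomials_def W_def[symmetric] by blast
    also have "\<dots> = ?gens"
      unfolding p_mult p_pow p_gen W le h_def three by blast
    finally show ?thesis by (rule sym)
  qed
  have M_monomials: "p f \<in> M" if "f \<in> K.monomials m n" for f
    using that M_w pM.mult_left_mem by (fastforce simp: K.monomials_def)
  have gens_closed: "?gens \<subseteq> carrier ?F"
    unfolding gens by (auto simp: M_monomials)
  have p_zero: "p 0 = \<one>\<^bsub>(add_monoid A)\<lparr>carrier := M\<rparr>\<^esub>"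
    using p.hom_zero by simp
  have h_zero: "h (p 0) = \<one>\<^bsub>?F\<^esub>"
    unfolding p_zero by (rule h.hom_one)
  \<comment> \<open>Membership in \<open>M\<close> is carried through the induction because
    \<open>h\<close> is a homomorphism only there.\<close>
  have M_closure: "p s \<in> M \<and> h (p s) \<in> generate ?F ?gens"
    if "s \<in> group_closure (K.monomials m n)" for s
    using that
  proof (induction s rule: group_closure.induct)
    case (base s)
    then consider "s = 0" | "s \<in> K.monomials m n"
      by blast
    then show ?case
    proof cases
      case 1
      then show ?thesis
        using pM.zero_mem h_zero generate.one[of ?F ?gens] by (simp only: mem_Collect_eq simp_thms)
    next
      case 2
      then have "h (p s) \<in> ?gens"
        unfolding gens by (rule imageI)
      then show ?thesis
        using M_monomials[OF 2] generate.incl by (intro conjI)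
    qed
  next
    case (diff s t)
    then have M: "p s \<in> M" "p t \<in> M" "p (s - t) \<in> M"
      using pM.diff_mem[of s t] by blast+
    have "p s = p (s - t) \<oplus>\<^bsub>A\<^esub> p t"
      using p.hom_add[of "s - t" t] by simp
    then have "h (p s) = h (p (s - t)) \<otimes>\<^bsub>?F\<^esub> h (p t)"
      using h.hom_mult[of "p (s - t)" "p t"] M by simp
    then have "h (p (s - t)) = h (p s) \<otimes>\<^bsub>?F\<^esub> inv\<^bsub>?F\<^esub> h (p t)"
      using h.hom_closed M by (subst h.H.inv_solve_right) auto
    also have "\<dots> \<in> generate ?F ?gens"
      using diff.IH by (intro generate.eng h.H.generate_m_inv_closed[OF gens_closed]) blast+
    finally show ?case
      using M(3) by (intro conjI)
  qed

  show ?thesis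
  proof
    show "generate ?F ?gens \<subseteq> carrier ?F"
      by (rule h.H.generate_incl[OF gens_closed])
    show "carrier ?F \<subseteq> generate ?F ?gens"
    proof
      fix c assume "c \<in> carrier ?F"
      then have "c \<in> h ` M"
        unfolding hom(2) .
      then obtain x where x: "x \<in> M" "c = h x"
        by (rule imageE)
      have "x \<in> p ` S"
        by (rule subsetD[OF M_subset x(1)])
      then obtain f where f: "f \<in> S" "p f \<in> M" "c = h (p f)"
        using x by auto
      then obtain s where s: "s \<in> group_closure (K.monomials m n)" "f - s \<in> K"
        by (auto simp: S_def K.span_mod_def)
      then obtain k :: nat where k: "k > 0" "p (of_nat k * (f - s)) \<in> N"
        by (auto simp: K_def)
      \<comment> \<open>Both \<open>p f\<close> and \<open>p s\<close> lie in \<open>M\<close>, so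
        \<open>h\<close> may be applied to the difference; a multiple of it lies in
        \<open>N\<close>, hence \<open>f\<close> and \<open>s\<close> have the same class.\<close>
      have "p (f - s) \<in> M"
        using pM.diff_mem[of f s] f(2) M_closure[OF s(1), THEN conjunct1] by simp
      then have "h (p (f - s)) = \<one>\<^bsub>?F\<^esub>"
        using hom(3)[OF k(1) _ k(2)[unfolded p_of_nat_mult]] by blast
      moreover have "p f = p (f - s) \<oplus>\<^bsub>A\<^esub> p s"
        using p.hom_add[of "f - s" s] by simp
      ultimately have "c = h (p s)"
        using h.hom_mult[of "p (f - s)" "p s"] h.hom_closed[of "p s"] f(3)
          \<open>p (f - s) \<in> M\<close> M_closure[OF s(1), THEN conjunct1]
        by simp
      then show "c \<in> generate ?F ?gens"
        using M_closure[OF s(1), THEN conjunct2] by (simp only:)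
    qed
  qed
qed

end
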